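(* For $\alpha>0$, let $\mathcal{C}\subseteq\mathbb{R}^d$ be a compact $\alpha$-strongly convex set of diameter $\delta>0$, let $f\colon\mathcal{C}\to\mathbb{R}$ be a convex and $L$-smooth function such that $\|\nabla f(x)\|_2\ge\lambda$ for all $x\in\mathcal{C}$ for some $\lambda>0$, with unique minimizer $x^*\in\operatorname{argmin}_{x\in\mathcal{C}}f(x)$. Let $T\in\mathbb{N}$ and write $h_t=f(x_t)-f(x^* )$ for the iterates $x_t$ of the Frank-Wolfe algorithm. (i) Let $\ell\in\mathbb{N}_{\ge2}$ and consider the Frank-Wolfe algorithm with step-sizes $\eta_t=\frac{\ell}{t+\ell}$. There exists $S\in\mathbb{N}$ depending only on $L,\alpha,\delta,\lambda,\ell$ such that $h_{t+1}\le\left(1-\frac{\eta_t}{2}\right)h_t$ for all $t\in\{S,\ldots,T-1\}$. If, moreover, $\ell$ is even, then $$h_t\le h_S\,\frac{(S+\ell/2)(S+\ell/2+1)\cdots(S+\ell-1)}{(t+\ell/2)(t+\ell/2+1)\cdots(t+\ell-1)}$$ for all $t\in\{S,\ldots,T-1\}$, resulting in a convergence rate of order $\mathcal{O}(1/t^{\ell/2})$. (ii) The Frank-Wolfe algorithm with the constant step-size $\eta_t=\frac{\alpha\lambda}{2L}$ (assumed to lie in $[0,1]$) satisfies $h_t\le\left(1-\frac{\alpha\lambda}{4L}\right)^th_0$ for all $t\in\{0,\ldots,T\}$.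
   Context: Frank-Wolfe algorithm (FW): given $x_0\in\mathcal{C}$ and step-sizes $\eta_t\in[0,1]$ for $t\in\{0,\ldots,T-1\}$, for $t=0,\ldots,T-1$ choose $p_t\in\operatorname{argmin}_{p\in\mathcal{C}}\langle\nabla f(x_t),p-x_t\rangle$ and set $x_{t+1}=(1-\eta_t)x_t+\eta_tp_t$. $\alpha$-strongly convex set: for all $x,y\in\mathcal{C}$, $\gamma\in[0,1]$, and $z\in\mathbb{R}^d$ with $\|z\|_2=1$, it holds that $\gamma x+(1-\gamma)y+\gamma(1-\gamma)\alpha\|x-y\|_2^2\,z\in\mathcal{C}$. $L$-smooth ($L>0$): $f$ is differentiable in an open set containing $\mathcal{C}$ and $f(y)\le f(x)+\langle\nabla f(x),y-x\rangle+\frac{L}{2}\|x-y\|_2^2$ for all $x,y\in\mathcal{C}$. The diameter is with respect to $\|\cdot\|_2$. *)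

theory Defs
  imports "HOL-Analysis.Analysis" "HOL-Library.Landau_Symbols"
begin

text \<open>
  The constant of the convergence theorem must not depend on the dimension, so the dimension has to
  be quantified inside a formula, after that constant; it cannot be a type parameter. All
  spaces of real \<open>d\<close>-tuples are therefore taken inside one inner product space, the finitely
  supported real sequences, as the subspaces \<open>Rn d\<close> of sequences supported in \<open>{..<d}\<close>. On \<open>Rn d\<close>
  the inner product, norm, distance and topology are the Euclidean ones.
\<close>

typedef fin_seq = "{x :: nat \<Rightarrow> real. finite {i. x i \<noteq> 0}}"
  morphisms coord Fin_seq
  by (rule exI[of _ "\<lambda>_. 0"]) simp

setup_lifting type_definition_fin_seq

lemma fin_seq_eqI: "(\<And>i. coord x i = coord y i) \<Longrightarrow> x = y"
  by (simp add: coord_inject[symmetric] fun_eq_iff)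

lemma finite_coord: "finite {i. coord x i \<noteq> 0}"
  using coord[of x] by simp

instantiation fin_seq :: real_vector
begin

lift_definition zero_fin_seq :: fin_seq is "\<lambda>_. 0"
  by simp

lift_definition plus_fin_seq :: "fin_seq \<Rightarrow> fin_seq \<Rightarrow> fin_seq" is "\<lambda>x y i. x i + y i"
proof -
  fix x y :: "nat \<Rightarrow> real"
  assume "finite {i. x i \<noteq> 0}" "finite {i. y i \<noteq> 0}"
  then show "finite {i. x i + y i \<noteq> 0}"
    by (rule finite_subset[OF _ finite_UnI, rotated]) auto
qed

lift_definition minus_fin_seq :: "fin_seq \<Rightarrow> fin_seq \<Rightarrow> fin_seq" is "\<lambda>x y i. x i - y i"
proof -
  fix x y :: "nat \<Rightarrow> real"
  assume "finite {i. x i \<noteq> 0}" "finite {i. y i \<noteq> 0}"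
  then show "finite {i. x i - y i \<noteq> 0}"
    by (rule finite_subset[OF _ finite_UnI, rotated]) auto
qed

lift_definition uminus_fin_seq :: "fin_seq \<Rightarrow> fin_seq" is "\<lambda>x i. - x i"
  by simp

lift_definition scaleR_fin_seq :: "real \<Rightarrow> fin_seq \<Rightarrow> fin_seq" is "\<lambda>c x i. c * x i"
  by simp

instance
  by standard
    (rule fin_seq_eqI;
      simp add: plus_fin_seq.rep_eq zero_fin_seq.rep_eq minus_fin_seq.rep_eq
        uminus_fin_seq.rep_eq scaleR_fin_seq.rep_eq algebra_simps)+

end

lemmas coord_simps [simp] =
  plus_fin_seq.rep_eq zero_fin_seq.rep_eq minus_fin_seq.rep_eq uminus_fin_seq.rep_eq
  scaleR_fin_seq.rep_eq

lemma sum_coord_superset: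
  assumes "finite A" "{i. coord x i \<noteq> 0} \<subseteq> A"
  shows "(\<Sum>i | coord x i \<noteq> 0. coord x i * coord y i) = (\<Sum>i\<in>A. coord x i * coord y i)"
  using assms by (intro sum.mono_neutral_left) auto

instantiation fin_seq :: real_inner
begin

definition inner_fin_seq :: "fin_seq \<Rightarrow> fin_seq \<Rightarrow> real" where
  "inner_fin_seq x y = (\<Sum>i | coord x i \<noteq> 0. coord x i * coord y i)"

definition norm_fin_seq :: "fin_seq \<Rightarrow> real" where
  "norm_fin_seq x = sqrt (inner x x)"

definition sgn_fin_seq :: "fin_seq \<Rightarrow> fin_seq" where
  "sgn_fin_seq x = x /\<^sub>R norm x"

definition dist_fin_seq :: "fin_seq \<Rightarrow> fin_seq \<Rightarrow> real" where
  "dist_fin_seq x y = norm (x - y)"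

definition uniformity_fin_seq :: "(fin_seq \<times> fin_seq) filter" where
  "uniformity_fin_seq = (INF e\<in>{0<..}. principal {(x, y). dist x y < e})"

definition open_fin_seq :: "fin_seq set \<Rightarrow> bool" where
  "open_fin_seq U \<longleftrightarrow> (\<forall>x\<in>U. eventually (\<lambda>(x', y). x' = x \<longrightarrow> y \<in> U) uniformity)"

instance
proof
  fix x y z :: fin_seq and r :: real
  let ?A = "{i. coord x i \<noteq> 0} \<union> {i. coord y i \<noteq> 0}"
  have A: "finite ?A"
    by (simp add: finite_coord)
  show "inner x y = inner y x"
    unfolding inner_fin_seq_def
    by (subst (1 2) sum_coord_superset[OF A]) (auto intro: sum.cong simp: mult.commute)
  show "inner (x + y) z = inner x z + inner y z"
    unfolding inner_fin_seq_def
    by (subst (1 2 3) sum_coord_superset[OF A]) (auto simp: algebra_simps sum.distrib)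
  show "inner (r *\<^sub>R x) y = r * inner x y"
    unfolding inner_fin_seq_def
    by (subst (1 2) sum_coord_superset[OF A]) (auto simp: sum_distrib_left mult.assoc)
  show "0 \<le> inner x x"
    unfolding inner_fin_seq_def by (intro sum_nonneg) simp
  show "inner x x = 0 \<longleftrightarrow> x = 0"
    unfolding inner_fin_seq_def
    by (subst sum_nonneg_eq_0_iff) (auto simp: finite_coord intro: fin_seq_eqI)
qed (simp_all only: norm_fin_seq_def sgn_fin_seq_def dist_fin_seq_def uniformity_fin_seq_def
       open_fin_seq_def)

end

definition Rn :: "nat \<Rightarrow> fin_seq set" where
  "Rn d = {x. \<forall>i\<ge>d. coord x i = 0}"

lemma subspace_Rn: "subspace (Rn d)"
  by (auto simp: subspace_def Rn_def)

lemma inner_Rn: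
  assumes "x \<in> Rn d"
  shows "inner x y = (\<Sum>i<d. coord x i * coord y i)"
  unfolding inner_fin_seq_def
  using assms by (intro sum_coord_superset) (auto simp: Rn_def not_le[symmetric])

definition gradient :: "nat \<Rightarrow> (fin_seq \<Rightarrow> real) \<Rightarrow> fin_seq \<Rightarrow> fin_seq" where
  "gradient d f x =
    (THE g. g \<in> Rn d \<and> (f has_derivative (\<lambda>h. inner g h)) (at x within Rn d))"

lift_definition unit_seq :: "nat \<Rightarrow> fin_seq" is "\<lambda>k i. if i = k then 1 else 0"
  by simp

lemma coord_sum: "coord (sum g A) i = (\<Sum>a\<in>A. coord (g a) i)"
  by (induction A rule: infinite_finite_induct) auto

lemma Rn_expansion:
  assumes "x \<in> Rn d"
  shows "x = (\<Sum>k<d. coord x k *\<^sub>R unit_seq k)"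
proof (rule fin_seq_eqI)
  fix i
  show "coord x i = coord (\<Sum>k<d. coord x k *\<^sub>R unit_seq k) i"
    using assms by (auto simp: coord_sum unit_seq.rep_eq Rn_def if_distrib cong: if_cong)
qed

text \<open>The description in the definition of \<open>gradient\<close> is proper at points of differentiability.\<close>

lemma gradient_works:
  assumes "x \<in> Rn d" and "f differentiable (at x within Rn d)"
  shows "gradient d f x \<in> Rn d"
    and "(f has_derivative (\<lambda>h. inner (gradient d f x) h)) (at x within Rn d)"
proof -
  let ?P = "\<lambda>g. g \<in> Rn d \<and> (f has_derivative (\<lambda>h. inner g h)) (at x within Rn d)"
  obtain D where D: "(f has_derivative D) (at x within Rn d)"
    using assms(2) by (auto simp: differentiable_def)
  then interpret D: bounded_linear D
    by (rule has_derivative_bounded_linear)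
  define g where "g = (\<Sum>k<d. D (unit_seq k) *\<^sub>R unit_seq k)"
  have g: "g \<in> Rn d"
    by (auto simp: g_def Rn_def coord_sum unit_seq.rep_eq)
  have coord_g: "coord g k = D (unit_seq k)" if "k < d" for k
    using that by (simp add: g_def coord_sum unit_seq.rep_eq if_distrib cong: if_cong)
  have Dg: "D h = inner g h" if "h \<in> Rn d" for h
  proof -
    have "D h = (\<Sum>k<d. coord h k * D (unit_seq k))"
      by (subst Rn_expansion[OF that]) (simp add: D.sum D.scaleR)
    then show ?thesis
      by (simp add: inner_Rn[OF g] coord_g mult.commute)
  qed
  have "(f has_derivative (\<lambda>h. inner g h)) (at x within Rn d)"
    using D unfolding has_derivative_within
  proof (elim conjE, intro conjI)
    show "bounded_linear (\<lambda>h. inner g h)"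
      by (rule bounded_linear_inner_right)
    assume lim: "((\<lambda>y. (1 / norm (y - x)) *\<^sub>R (f y - (f x + D (y - x)))) \<longlongrightarrow> 0) (at x within Rn d)"
    show "((\<lambda>y. (1 / norm (y - x)) *\<^sub>R (f y - (f x + inner g (y - x)))) \<longlongrightarrow> 0) (at x within Rn d)"
      by (rule Lim_transform_within[OF lim, of 1])
        (auto simp: Dg subspace_diff[OF subspace_Rn] assms(1))
  qed
  with g have P: "?P g"
    by blast
  have unique: "g' = g" if "?P g'" for g'
  proof -
    have g': "g' \<in> Rn d" "(f has_derivative (\<lambda>h. inner g' h)) (at x within Rn d)"
      using that by auto
    define w where "w = g' - g"
    have w: "w \<in> Rn d"
      using g g'(1) by (simp add: w_def subspace_diff[OF subspace_Rn])
    define c where "c = (\<lambda>s. x + s *\<^sub>R w)"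
    have c: "(c has_derivative (\<lambda>s. s *\<^sub>R w)) (at (0::real))"
      unfolding c_def by (auto intro!: derivative_eq_intros)
    have cR: "range c \<subseteq> Rn d"
      using w assms(1) by (auto simp: c_def subspace_add[OF subspace_Rn] subspace_scale[OF subspace_Rn])
    have c0: "c 0 = x"
      by (simp add: c_def)
    have comp: "((\<lambda>s. f (c s)) has_derivative (\<lambda>s. inner v (s *\<^sub>R w))) (at 0)" if "?P v" for v
    proof -
      have "(f has_derivative (\<lambda>h. inner v h)) (at (c 0) within range c)"
        using that cR c0 by (auto intro: has_derivative_subset)
      from diff_chain_within[OF c this] show ?thesis
        by (simp add: o_def)
    qed
    have "(\<lambda>s. inner g' (s *\<^sub>R w)) = (\<lambda>s. inner g (s *\<^sub>R w))"
      by (rule has_derivative_unique[OF comp comp]) (use that P in auto)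
    from fun_cong[OF this, of 1] have "inner w w = 0"
      by (simp add: w_def inner_diff_left)
    then show "g' = g"
      by (simp add: w_def)
  qed
  have "?P (gradient d f x)"
    unfolding gradient_def by (rule theI[of ?P, OF P unique])
  then show "gradient d f x \<in> Rn d"
    and "(f has_derivative (\<lambda>h. inner (gradient d f x) h)) (at x within Rn d)"
    by auto
qed

definition strongly_convex_set :: "nat \<Rightarrow> real \<Rightarrow> fin_seq set \<Rightarrow> bool" where
  "strongly_convex_set d \<alpha> C \<longleftrightarrow>
    (\<forall>x\<in>C. \<forall>y\<in>C. \<forall>\<gamma>\<in>{0..1}. \<forall>z\<in>Rn d. norm z = 1 \<longrightarrow>
      \<gamma> *\<^sub>R x + (1 - \<gamma>) *\<^sub>R y + (\<gamma> * (1 - \<gamma>) * \<alpha> * (norm (x - y))\<^sup>2) *\<^sub>R z \<in> C)"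

definition smooth_on_set :: "nat \<Rightarrow> real \<Rightarrow> fin_seq set \<Rightarrow> (fin_seq \<Rightarrow> real) \<Rightarrow> bool" where
  "smooth_on_set d L C f \<longleftrightarrow>
    (\<exists>U. openin (top_of_set (Rn d)) U \<and> C \<subseteq> U \<and>
      (\<forall>x\<in>U. f differentiable (at x within Rn d))) \<and>
    (\<forall>x\<in>C. \<forall>y\<in>C. f y \<le> f x + inner (gradient d f x) (y - x) + L / 2 * (norm (x - y))\<^sup>2)"

text \<open>
  A run of \<open>T\<close> iterations; only the values \<open>x 0, \<dots>, x T\<close> are constrained. The choice of the
  minimizer \<open>p\<close> is left open when it is not unique.
\<close>

definition frank_wolfe ::
    "nat \<Rightarrow> fin_seq set \<Rightarrow> (fin_seq \<Rightarrow> real) \<Rightarrow> (nat \<Rightarrow> real) \<Rightarrow> nat \<Rightarrow> (nat \<Rightarrow> fin_seq) \<Rightarrow> bool" where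
  "frank_wolfe d C f \<eta> T x \<longleftrightarrow>
    x 0 \<in> C \<and>
    (\<forall>t<T. \<eta> t \<in> {0..1} \<and>
      (\<exists>p. is_arg_min (\<lambda>q. inner (gradient d f (x t)) (q - x t)) (\<lambda>q. q \<in> C) p \<and>
           x (Suc t) = (1 - \<eta> t) *\<^sub>R x t + \<eta> t *\<^sub>R p))"

text \<open>
  The standing hypotheses, with \<open>lam\<close> the lower bound of the gradient norm and \<open>xs\<close> the unique
  minimizer. Values of \<open>f\<close> away from the neighbourhood of \<open>C\<close> in \<open>smooth_on_set\<close> are irrelevant.
\<close>

definition fw_problem ::
    "real \<Rightarrow> real \<Rightarrow> real \<Rightarrow> real \<Rightarrow> nat \<Rightarrow> fin_seq set \<Rightarrow> (fin_seq \<Rightarrow> real) \<Rightarrow> fin_seq \<Rightarrow> bool" where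
  "fw_problem L \<alpha> \<delta> lam d C f xs \<longleftrightarrow>
    C \<subseteq> Rn d \<and> compact C \<and> strongly_convex_set d \<alpha> C \<and> diameter C = \<delta> \<and>
    convex_on C f \<and> smooth_on_set d L C f \<and>
    (\<forall>x\<in>C. norm (gradient d f x) \<ge> lam) \<and>
    {y. is_arg_min f (\<lambda>x. x \<in> C) y} = {xs}"

end

theory Submission
  imports Defs
begin

text \<open>
  With the unit vector \<open>z = - g / norm g\<close>, where \<open>g\<close> is the gradient at \<open>x\<close>, strong convexity makes
  the midpoint of \<open>x\<close> and the Frank--Wolfe vertex \<open>p\<close>, shifted by \<open>z\<close>, a competitor of \<open>p\<close>; hence
  \<open>inner g (p - x) \<le> - \<alpha> lam / 2 * (norm (p - x))\<^sup>2\<close>. Half of the progress \<open>\<eta> * inner g (p - x)\<close>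
  is spent on the primal gap, the other half absorbs the quadratic smoothness term as soon as
  \<open>\<eta> \<le> \<alpha> lam / (2 L)\<close>. This gives \<open>h (t + 1) \<le> (1 - \<eta> t / 2) * h t\<close>; for \<open>\<eta> t = l / (t + l)\<close> the factor
  is \<open>(t + l / 2) / (t + l)\<close>, whose product telescopes.
\<close>

section \<open>First-order inequalities for convex functions and strongly convex sets\<close>

text \<open>By convexity, the difference quotients of \<open>f\<close> along the segment from
  \<open>x\<close> to \<open>y\<close> are at most \<open>f y - f x\<close>, and the bound passes to
  their limit.\<close>

lemma convex_on_gradient_inequality:
  assumes f: "convex_on C f" and C: "C \<subseteq> Rn d" "x \<in> C" "y \<in> C"
    and D: "(f has_derivative (\<lambda>h. inner g h)) (at x within Rn d)"
  shows "inner g (y - x) \<le> f y - f x"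
proof -
  define c where "c = (\<lambda>s::real. x + s *\<^sub>R (y - x))"
  have c: "(c has_derivative (\<lambda>s. s *\<^sub>R (y - x))) (at 0)"
    unfolding c_def by (auto intro!: derivative_eq_intros)
  have "x \<in> Rn d" "y \<in> Rn d"
    using C by auto
  \<comment> \<open>The whole line, not only the segment, stays in \<open>Rn d\<close>, so
    differentiability within \<open>Rn d\<close> gives a two-sided derivative of
    \<open>\<lambda>s. f (c s)\<close> at 0.\<close>
  then have "range c \<subseteq> Rn d"
    by (auto simp: c_def intro!: subspace_add[OF subspace_Rn] subspace_scale[OF subspace_Rn]
        subspace_diff[OF subspace_Rn])
  then have "(f has_derivative (\<lambda>h. inner g h)) (at (c 0) within range c)"
    using D by (auto simp: c_def intro: has_derivative_subset)
  from diff_chain_within[OF c this]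
  have "((\<lambda>s. f (c s)) has_field_derivative inner g (y - x)) (at 0)"
    by (simp add: o_def has_field_derivative_def mult_commute_abs)
  then have "((\<lambda>s. (f (c s) - f x) / s) \<longlongrightarrow> inner g (y - x)) (at_right 0)"
    by (auto simp: has_field_derivative_iff c_def intro: tendsto_within_subset)
  moreover have "eventually (\<lambda>s::real. s \<in> {0<..<1}) (at_right 0)"
    by (rule eventually_at_right_real) simp
  then have "eventually (\<lambda>s. (f (c s) - f x) / s \<le> f y - f x) (at_right 0)"
  proof eventually_elim
    fix s :: real
    assume s: "s \<in> {0<..<1}"
    have "f ((1 - s) *\<^sub>R x + s *\<^sub>R y) \<le> (1 - s) * f x + s * f y"
      by (rule convex_onD[OF f]) (use s C in auto)
    moreover have "c s = (1 - s) *\<^sub>R x + s *\<^sub>R y"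
      by (simp add: c_def algebra_simps)
    ultimately have "f (c s) - f x \<le> (f y - f x) * s"
      by (simp only: left_diff_distrib mult.commute[of s])
    then show "(f (c s) - f x) / s \<le> f y - f x"
      using s by (simp add: pos_divide_le_eq)
  qed
  ultimately show ?thesis
    by (rule tendsto_upperbound) simp
qed

lemma strongly_convex_set_linear_minimizer:
  assumes C: "strongly_convex_set d \<alpha> C" and g: "g \<in> Rn d" "g \<noteq> 0" and x: "x \<in> C"
    and p: "is_arg_min (\<lambda>q. inner g (q - x)) (\<lambda>q. q \<in> C) p"
  shows "inner g (p - x) \<le> - (\<alpha> / 2 * norm g * (norm (p - x))\<^sup>2)"
proof -
  define z where "z = (- 1 / norm g) *\<^sub>R g"
  have pC: "p \<in> C"
    using p by (simp add: is_arg_min_def)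
  have z: "z \<in> Rn d" "norm z = 1"
    using g by (simp_all add: z_def subspace_scale[OF subspace_Rn] del: scaleR_minus_left)
  have gz: "inner g z = - norm g"
    using g by (simp add: z_def power2_norm_eq_inner[symmetric] power2_eq_square)
  \<comment> \<open>Strong convexity is applied with \<gamma> = 1/2, so the shift along
    \<open>z\<close> has length \<open>\<alpha> / 4 * (norm (p - x))\<^sup>2\<close>.\<close>
  define q where "q = (1/2) *\<^sub>R x + (1 - 1/2) *\<^sub>R p + (1/2 * (1 - 1/2) * \<alpha> * (norm (x - p))\<^sup>2) *\<^sub>R z"
  have "q \<in> C"
    unfolding q_def
    by (rule C[unfolded strongly_convex_set_def, rule_format]) (use x pC z in auto)
  then have "inner g (p - x) \<le> inner g (q - x)"
    using p by (auto simp: is_arg_min_def not_less)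
  also have "q - x = (1/2) *\<^sub>R (p - x) + (\<alpha> / 4 * (norm (p - x))\<^sup>2) *\<^sub>R z"
  proof -
    have "(1/2) *\<^sub>R x - x = - ((1/2) *\<^sub>R x)"
      using scaleR_left_diff_distrib[of "1/2" 1 x] by (simp add: algebra_simps)
    then show ?thesis
      by (simp add: q_def norm_minus_commute[of p x] algebra_simps)
  qed
  \<comment> \<open>Half of \<open>inner g (p - x)\<close> moves to the left; doubling then turns
    \<alpha>/4 into \<alpha>/2.\<close>
  finally show ?thesis
    by (simp add: inner_add_right gz algebra_simps)
qed

section \<open>Frank-Wolfe iterates and the one-step contraction\<close>

lemma frank_wolfe_in_set:
  assumes "frank_wolfe d C f \<eta> T x" "convex C" "t \<le> T"
  shows "x t \<in> C"
  using assms(3)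
proof (induction t)
  case 0
  then show ?case
    using assms(1) by (simp add: frank_wolfe_def)
next
  case (Suc t)
  then have xt: "x t \<in> C" and t: "t < T"
    by simp_all
  obtain p where "p \<in> C" "x (Suc t) = (1 - \<eta> t) *\<^sub>R x t + \<eta> t *\<^sub>R p" "\<eta> t \<in> {0..1}"
    using assms(1) t by (auto simp: frank_wolfe_def is_arg_min_def)
  then show ?case
    using convexD[OF assms(2) xt, of p "1 - \<eta> t" "\<eta> t"] by simp
qed

lemma fw_problem_minimizer:
  assumes "fw_problem L \<alpha> \<delta> lam d C f xs"
  shows "xs \<in> C" "\<And>y. y \<in> C \<Longrightarrow> f xs \<le> f y"
proof -
  have "is_arg_min f (\<lambda>x. x \<in> C) xs"
    using assms by (auto simp: fw_problem_def)
  then show "xs \<in> C" "\<And>y. y \<in> C \<Longrightarrow> f xs \<le> f y"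
    by (auto simp: is_arg_min_def not_less)
qed

lemma fw_problem_iterate:
  assumes fw: "fw_problem L \<alpha> \<delta> lam d C f xs" and run: "frank_wolfe d C f \<eta> T x" and t: "t \<le> T"
  shows "x t \<in> C" "0 \<le> f (x t) - f xs"
proof -
  \<comment> \<open>\<open>convex_on\<close> includes convexity of the domain.\<close>
  have "convex C"
    using fw by (auto simp: fw_problem_def convex_on_def)
  then show "x t \<in> C"
    using frank_wolfe_in_set run t by blast
  then show "0 \<le> f (x t) - f xs"
    using fw_problem_minimizer(2)[OF fw] by simp
qed

lemma frank_wolfe_step:
  assumes fw: "fw_problem L \<alpha> \<delta> lam d C f xs" and run: "frank_wolfe d C f \<eta> T x" and t: "t < T"
    and pos: "0 < L" "0 < \<alpha>" "0 < lam" and \<eta>: "\<eta> t \<le> \<alpha> * lam / (2 * L)"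
  shows "f (x (Suc t)) - f xs \<le> (1 - \<eta> t / 2) * (f (x t) - f xs)"
proof -
  note defs = fw[unfolded fw_problem_def]
  have xC: "x t \<in> C" and x'C: "x (Suc t) \<in> C"
    using fw_problem_iterate(1)[OF fw run] t by auto
  define g where "g = gradient d f (x t)"
  obtain p where p: "is_arg_min (\<lambda>q. inner g (q - x t)) (\<lambda>q. q \<in> C) p"
    and x': "x (Suc t) = (1 - \<eta> t) *\<^sub>R x t + \<eta> t *\<^sub>R p" and \<eta>0: "0 \<le> \<eta> t"
    using run t by (auto simp: frank_wolfe_def g_def)
  have "x t \<in> Rn d" "f differentiable (at (x t) within Rn d)"
    using defs xC by (auto simp: smooth_on_set_def)
  note grad = gradient_works[OF this, folded g_def]
  have ng: "lam \<le> norm g"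
    using defs xC by (simp add: g_def)
  then have "g \<noteq> 0"
    using pos by auto
  define n where "n = (norm (p - x t))\<^sup>2"
  have "inner g (p - x t) \<le> - (\<alpha> / 2 * norm g * n)"
    unfolding n_def
    by (rule strongly_convex_set_linear_minimizer[OF _ grad(1) \<open>g \<noteq> 0\<close> xC p]) (use defs in simp)
  also have "\<dots> \<le> - (\<alpha> / 2 * lam * n)"
    using ng pos by (simp add: n_def mult_left_mono mult_right_mono)
  finally have strong: "inner g (p - x t) \<le> - (\<alpha> / 2 * lam * n)" .
  have "inner g (p - x t) \<le> inner g (xs - x t)"
    using p fw_problem_minimizer(1)[OF fw] by (auto simp: is_arg_min_def not_less)
  also have "\<dots> \<le> f xs - f (x t)"
    by (rule convex_on_gradient_inequality[OF _ _ xC fw_problem_minimizer(1)[OF fw] grad(2)])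
      (use defs in auto)
  finally have gap: "inner g (p - x t) \<le> - (f (x t) - f xs)"
    by simp
  have diff: "x (Suc t) - x t = \<eta> t *\<^sub>R (p - x t)"
    by (simp add: x' algebra_simps)
  have "f (x (Suc t)) \<le> f (x t) + inner g (x (Suc t) - x t) + L / 2 * (norm (x t - x (Suc t)))\<^sup>2"
    using defs xC x'C by (simp add: smooth_on_set_def g_def)
  also have "\<dots> = f (x t) + \<eta> t * inner g (p - x t) + L / 2 * (\<eta> t)\<^sup>2 * n"
    by (subst norm_minus_commute) (simp add: diff n_def power_mult_distrib)
  finally have "f (x (Suc t)) \<le> f (x t) + \<eta> t * inner g (p - x t) + L / 2 * (\<eta> t)\<^sup>2 * n" .
  \<comment> \<open>The sum of \<open>strong\<close> and \<open>gap\<close>: one copy of the inner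
    product pays for the primal gap, the other for the quadratic term.\<close>
  moreover have "\<eta> t * (2 * inner g (p - x t))
      \<le> \<eta> t * (- (f (x t) - f xs) - \<alpha> / 2 * lam * n)"
    using strong gap \<eta>0 by (intro mult_left_mono) auto
  \<comment> \<open>The step-size bound enters here, as
    \<open>L * \<eta> t \<le> \<alpha> * lam / 2\<close>.\<close>
  moreover have "(\<eta> t * n) * (L * \<eta> t) \<le> (\<eta> t * n) * (\<alpha> * lam / 2)"
    using \<eta> \<eta>0 pos by (intro mult_left_mono) (simp_all add: n_def field_simps)
  \<comment> \<open>The remaining identities write the nonlinear terms through common products,
    leaving a linear problem.\<close>
  moreover have "L / 2 * (\<eta> t)\<^sup>2 * n = (\<eta> t * n) * (L * \<eta> t) / 2"
    by (simp add: power2_eq_square)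
  moreover have "\<eta> t * (- (f (x t) - f xs) - \<alpha> / 2 * lam * n)
      = - (\<eta> t * (f (x t) - f xs)) - (\<eta> t * n) * (\<alpha> * lam / 2)"
    by (simp add: algebra_simps)
  moreover have "(1 - \<eta> t / 2) * (f (x t) - f xs) = f (x t) - f xs - \<eta> t * (f (x t) - f xs) / 2"
    by (simp add: algebra_simps)
  ultimately show ?thesis
    by linarith
qed

section \<open>Telescoping of the contraction factors\<close>

text \<open>Passing from \<open>t\<close> to \<open>Suc t\<close> trades the lowest factor
  \<open>t + l div 2\<close> for a new top factor \<open>t + l\<close>; evenness identifies
  \<open>l div 2\<close> with l/2.\<close>

lemma shifted_prod_Suc:
  fixes t l :: nat
  assumes "even l" "l > 0"
  shows "(\<Prod>j = l div 2..l - 1. real (Suc t + j)) * (real t + real l / 2) =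
    (\<Prod>j = l div 2..l - 1. real (t + j)) * (real t + real l)"
proof -
  have ivl: "{l div 2..l - 1} = {l div 2..<l}"
    using assms by auto
  have "(\<Prod>j = l div 2..<l. real (Suc t + j)) = (\<Prod>j = Suc (l div 2)..<Suc l. real (t + j))"
    by (subst prod.shift_bounds_Suc_ivl) simp
  moreover have "(\<Prod>j = l div 2..<Suc l. real (t + j)) =
      real (t + l div 2) * (\<Prod>j = Suc (l div 2)..<Suc l. real (t + j))"
    by (rule prod.atLeast_Suc_lessThan) simp
  moreover have "(\<Prod>j = l div 2..<Suc l. real (t + j)) =
      (\<Prod>j = l div 2..<l. real (t + j)) * real (t + l)"
    by (rule prod.atLeastLessThan_Suc) simp
  moreover have "real (t + l div 2) = real t + real l / 2"
    using assms by (simp add: real_of_nat_div)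
  ultimately show ?thesis
    unfolding ivl by (simp add: mult.commute)
qed

lemma shifted_prod_pos:
  assumes "l \<ge> 2"
  shows "0 < (\<Prod>j = l div 2..l - 1. real (t + j))"
  using assms by (intro prod_pos) auto

text \<open>The product has l/2 factors, each at least \<open>t\<close>; this turns the product
  bound into the rate of order 1/t^(l/2).\<close>

lemma power_le_shifted_prod:
  assumes "even l" "l > 0"
  shows "real t ^ (l div 2) \<le> (\<Prod>j = l div 2..l - 1. real (t + j))"
proof -
  have "card {l div 2..l - 1} = l div 2"
    using assms by (auto elim!: evenE)
  then have "real t ^ (l div 2) = (\<Prod>j = l div 2..l - 1. real t)"
    by (simp only: prod_constant)
  also have "\<dots> \<le> (\<Prod>j = l div 2..l - 1. real (t + j))"
    by (intro prod_mono) auto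
  finally show ?thesis .
qed

text \<open>The contraction factor (t + l/2) / (t + l) is the quotient of the products at
  \<open>t\<close> and \<open>Suc t\<close>, so \<open>h t\<close> times the product at
  \<open>t\<close> does not increase.\<close>

lemma contraction_shifted_prod_bound:
  fixes h :: "nat \<Rightarrow> real"
  assumes l: "even l" "l \<ge> 2"
    and step: "\<And>t. S \<le> t \<Longrightarrow> t < T \<Longrightarrow> h (Suc t) \<le> (1 - (real l / (real t + real l)) / 2) * h t"
    and t: "S \<le> t" "t \<le> T"
  shows "h t \<le> h S * ((\<Prod>j = l div 2..l - 1. real (S + j)) / (\<Prod>j = l div 2..l - 1. real (t + j)))"
proof -
  let ?P = "\<lambda>t. \<Prod>j = l div 2..l - 1. real (t + j)"
  have "h t * ?P t \<le> h S * ?P S"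
    using t
  proof (induction t rule: dec_induct)
    case base
    then show ?case by simp
  next
    case (step n)
    have "real n + real l > 0"
      using l by simp
    then have "1 - (real l / (real n + real l)) / 2 = (real n + real l / 2) / (real n + real l)"
      by (simp add: field_simps)
    then have "h (Suc n) * ?P (Suc n) \<le> (real n + real l / 2) / (real n + real l) * h n * ?P (Suc n)"
      using assms(3)[of n] step shifted_prod_pos[OF l(2), of "Suc n"]
      by (intro mult_right_mono) auto
    also have "\<dots> = h n * (?P (Suc n) * (real n + real l / 2)) / (real n + real l)"
      by simp
    also have "\<dots> = h n * ?P n"
      using \<open>real n + real l > 0\<close> l by (subst shifted_prod_Suc) auto
    also have "\<dots> \<le> h S * ?P S"
      using step by simp
    finally show ?case .
  qed
  then show ?thesis
    using shifted_prod_pos[OF l(2), of t] by (simp add: field_simps)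
qed

section \<open>Convergence rates for both step-size rules\<close>

theorem mainTheorem3:
  fixes L \<alpha> \<delta> lam :: real
  assumes "L > 0" and "\<alpha> > 0" and "\<delta> > 0" and "lam > 0"
  shows
    "(\<forall>l::nat. l \<ge> 2 \<longrightarrow>
        (\<exists>S::nat.
          (\<forall>d C f xs T x.
             fw_problem L \<alpha> \<delta> lam d C f xs \<and>
             frank_wolfe d C f (\<lambda>t. real l / (real t + real l)) T x \<longrightarrow>
             (\<forall>t\<in>{S..<T}.
                f (x (Suc t)) - f xs \<le> (1 - (real l / (real t + real l)) / 2) * (f (x t) - f xs)) \<and>
             (even l \<longrightarrow>
                (\<forall>t\<in>{S..<T}.
                   f (x t) - f xs \<le> (f (x S) - f xs) *
                     ((\<Prod>j = l div 2..l - 1. real (S + j)) /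
                      (\<Prod>j = l div 2..l - 1. real (t + j)))))) \<and>
          (even l \<longrightarrow>
             (\<exists>K\<ge>0. \<forall>d C f xs T x.
                fw_problem L \<alpha> \<delta> lam d C f xs \<and>
                frank_wolfe d C f (\<lambda>t. real l / (real t + real l)) T x \<longrightarrow>
                (\<forall>t\<in>{S..<T}. t > 0 \<longrightarrow>
                   f (x t) - f xs \<le> K * (f (x S) - f xs) / real t ^ (l div 2))) \<and>
             (\<forall>d C f xs x.
                fw_problem L \<alpha> \<delta> lam d C f xs \<and>
                (\<forall>T. frank_wolfe d C f (\<lambda>t. real l / (real t + real l)) T x) \<longrightarrow>
                (\<lambda>t. f (x t) - f xs) \<in> O(\<lambda>t. 1 / real t ^ (l div 2)))))) \<and>
     (\<forall>d C f xs T x.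
        \<alpha> * lam / (2 * L) \<in> {0..1} \<and>
        fw_problem L \<alpha> \<delta> lam d C f xs \<and>
        frank_wolfe d C f (\<lambda>_. \<alpha> * lam / (2 * L)) T x \<longrightarrow>
        (\<forall>t\<in>{0..T}. f (x t) - f xs \<le> (1 - \<alpha> * lam / (4 * L)) ^ t * (f (x 0) - f xs)))"
proof (intro conjI allI impI, goal_cases)
  case l: (1 l)
  define \<eta> where "\<eta> = (\<lambda>t::nat. real l / (real t + real l))"
  define b where "b = \<alpha> * lam / (2 * L)"
  have b: "b > 0"
    using assms by (simp add: b_def)
  \<comment> \<open>\<open>S\<close> is fixed from \<open>l\<close> and \<open>b\<close> before any
    problem or dimension; from \<open>S\<close> on, l/(t + l) is at most \<open>b\<close>.\<close>
  obtain S :: nat where S: "real l / b \<le> real S"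
    using real_arch_simple by blast
  have \<eta>S: "\<eta> t \<le> b" if "S \<le> t" for t
  proof -
    have "real l / b \<le> real t + real l"
      using S that by (simp add: order_trans)
    then show ?thesis
      using b l by (simp add: \<eta>_def field_simps)
  qed
  let ?P = "\<lambda>t. \<Prod>j = l div 2..l - 1. real (t + j)"
  have step: "f (x (Suc t)) - f xs \<le> (1 - \<eta> t / 2) * (f (x t) - f xs)"
    if "fw_problem L \<alpha> \<delta> lam d C f xs" "frank_wolfe d C f \<eta> T x" "t \<in> {S..<T}"
    for d C f xs T x t
    using frank_wolfe_step[OF that(1,2) _ assms(1,2,4)] \<eta>S[of t] that(3) by (simp add: b_def)
  have bound: "f (x t) - f xs \<le> (f (x S) - f xs) * (?P S / ?P t)"
    if "fw_problem L \<alpha> \<delta> lam d C f xs" "frank_wolfe d C f \<eta> T x" "even l" "t \<in> {S..<T}"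
    for d C f xs T x t
    using contraction_shifted_prod_bound[OF that(3) l, of S T "\<lambda>t. f (x t) - f xs" t]
      step[OF that(1,2)] that(4) by (simp add: \<eta>_def)
  have rate: "f (x t) - f xs \<le> ?P S * (f (x S) - f xs) / real t ^ (l div 2)"
    if fw: "fw_problem L \<alpha> \<delta> lam d C f xs" "frank_wolfe d C f \<eta> T x"
      and t: "even l" "t \<in> {S..<T}" "t > 0"
    for d C f xs T x t
  proof -
    have "f (x t) - f xs \<le> (f (x S) - f xs) * ?P S / ?P t"
      using bound[OF fw t(1,2)] by simp
    \<comment> \<open>Shrinking the denominator enlarges the quotient because the gap at
      \<open>S\<close> is nonnegative.\<close>
    also have "\<dots> \<le> (f (x S) - f xs) * ?P S / real t ^ (l div 2)"
    proof (intro divide_left_mono mult_nonneg_nonneg mult_pos_pos)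
      show "real t ^ (l div 2) \<le> ?P t"
        using power_le_shifted_prod t l by simp
      show "0 \<le> f (x S) - f xs"
        using fw_problem_iterate(2)[OF fw] t by simp
      show "0 \<le> ?P S" "0 < ?P t"
        using shifted_prod_pos[OF l] less_imp_le by blast+
    qed (use t in simp)
    finally show ?thesis
      by (simp add: mult.commute)
  qed
  have big_o: "(\<lambda>t. f (x t) - f xs) \<in> O(\<lambda>t. 1 / real t ^ (l div 2))"
    if fw: "fw_problem L \<alpha> \<delta> lam d C f xs" "\<forall>T. frank_wolfe d C f \<eta> T x" and "even l"
    for d C f xs x
  proof (rule bigoI)
    show "eventually (\<lambda>t. norm (f (x t) - f xs)
        \<le> ?P S * (f (x S) - f xs) * norm (1 / real t ^ (l div 2))) sequentially"
      \<comment> \<open>Starting at \<open>Suc S\<close> makes \<open>t\<close> positive;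
        \<open>rate\<close> is used for the run of length \<open>Suc t\<close>, so that
        \<open>t\<close> lies in \<open>{S..<Suc t}\<close>.\<close>
      using eventually_ge_at_top[of "Suc S"]
    proof eventually_elim
      fix t
      assume "Suc S \<le> t"
      then show "norm (f (x t) - f xs) \<le> ?P S * (f (x S) - f xs) * norm (1 / real t ^ (l div 2))"
        using rate[OF fw(1) fw(2)[rule_format, of "Suc t"] \<open>even l\<close>, of t]
          fw_problem_iterate(2)[OF fw(1) fw(2)[rule_format, of "Suc t"], of t]
        by simp
    qed
  qed
  have ex_K: "\<exists>K\<ge>0. \<forall>d C f xs T x.
      fw_problem L \<alpha> \<delta> lam d C f xs \<and> frank_wolfe d C f \<eta> T x \<longrightarrow>
      (\<forall>t\<in>{S..<T}. t > 0 \<longrightarrow> f (x t) - f xs \<le> K * (f (x S) - f xs) / real t ^ (l div 2))"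
    if "even l"
    \<comment> \<open>The witness depends only on \<open>S\<close> and \<open>l\<close>, hence is
      uniform over all problems.\<close>
    using rate[OF _ _ that] shifted_prod_pos[OF l, of S] by (intro exI[of _ "?P S"]) auto
  show ?case
  proof (intro exI[of _ S] conjI allI impI, goal_cases)
    case (1 d C f xs T x)
    then show ?case
      using step by (auto simp: \<eta>_def)
  next
    case (2 d C f xs T x)
    then show ?case
      using bound by (auto simp: \<eta>_def)
  next
    case 3
    then show ?case
      using ex_K by (simp add: \<eta>_def)
  next
    case (4 d C f xs x)
    then show ?case
      using big_o by (auto simp: \<eta>_def)
  qed
next
  case H: (2 d C f xs T x)
  show ?case
  proof
    fix t
    assume "t \<in> {0..T}"
    then have "t \<le> T"
      by simp
    then show "f (x t) - f xs \<le> (1 - \<alpha> * lam / (4 * L)) ^ t * (f (x 0) - f xs)"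
    proof (induction t)
      case 0
      then show ?case by simp
    next
      case (Suc t)
      let ?q = "1 - \<alpha> * lam / (4 * L)"
      \<comment> \<open>The constant step meets the bound of \<open>frank_wolfe_step\<close> with
        equality.\<close>
      have "f (x (Suc t)) - f xs \<le> ?q * (f (x t) - f xs)"
        using frank_wolfe_step[of L \<alpha> \<delta> lam d C f xs "\<lambda>_. \<alpha> * lam / (2 * L)" T x t] H Suc.prems assms by simp
      \<comment> \<open>Since the step-size is at most 1, \<open>?q\<close> is at least 1/2, so
        multiplying the induction hypothesis by it preserves the inequality.\<close>
      also have "\<dots> \<le> ?q * (?q ^ t * (f (x 0) - f xs))"
        using Suc H assms(1) by (intro mult_left_mono) (auto simp: field_simps)
      finally show ?case
        by (simp add: mult.assoc)
    qed
  qed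
qed

end
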